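(* Let $\beta\in(0,1)$, $0<T<\infty$. For any $\lambda,u_0\in\mathbb R$, the linear initial value problem $$\partial_0^\beta u(x)=\lambda u(x)\ \text{ for } x\in(0,T],\qquad u(0)=u_0,$$ has a unique solution in $C_\beta[0,T]$, given by the series $u(x)=u_0\sum_{N=0}^\infty\lambda^N(I_0^\beta)^N1(x)$, where $1$ denotes the constant function; equivalently $$u(x)=u_0\sum_{N=0}^\infty\lambda^Nx^{\beta N}\prod_{n=1}^N\left(\frac{\Gamma(1+n\beta)}{\Gamma(n\beta+1-\beta)}-\frac{1}{\Gamma(1-\beta)}\right)^{-1},$$ with the convention that an empty product equals $1$ (and $u(x)=u_0$ if $\lambda=0$).
   Context: Fix $\beta\in(0,1)$ and $0<T<\infty$. $C\cap L^1(0,T]$ is the set of continuous, Lebesgue integrable real functions on $(0,T]$. For $\gamma\in(0,1)$ and $u\in C\cap L^1(0,T]$, $J_0^\gamma u(x)=\int_0^x\frac{(x-r)^{\gamma-1}}{\Gamma(\gamma)}u(r)\,dr$ (extended by $0$ at $x=0$ when $u\in C[0,T]$). Define $C_\beta(0,T]=\{u\in C\cap L^1(0,T]: J_0^{1-\beta}u\in C^1(0,T]\}$ and $C_\beta[0,T]=C[0,T]\cap C_\beta(0,T]$. For $u\in C_\beta(0,T]$, the censored fractional derivative is $\partial_0^\beta u(x)=\frac{d}{dx}J_0^{1-\beta}u(x)-\frac{x^{-\beta}}{\Gamma(1-\beta)}u(x)$, $x\in(0,T]$. For $\psi\in C[0,T]$, $\mathcal K\psi(x)=\int_0^x\frac{(x-r)^{\beta-1}r^{-\beta}}{\Gamma(\beta)\Gamma(1-\beta)}\psi(r)\,dr$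 for $x>0$ and $\mathcal K\psi(0)=\psi(0)$. The operator $I_0^\beta$ is $I_0^\beta g=\sum_{j=0}^\infty\mathcal K^jJ_0^\beta g$, with $\mathcal K^0$ the identity; $(I_0^\beta)^N$ is its $N$-fold iterate, $(I_0^\beta)^0$ being the identity. *)

theory Defs
  imports "HOL-Analysis.Analysis"
begin

text \<open>Functions on $(0,T]$ or $[0,T]$ are total functions on the reals, of which only the values on
  the interval matter. Continuity and differentiability are relative to the interval, hence
  one-sided at $T$.\<close>

definition CL1 :: "real \<Rightarrow> (real \<Rightarrow> real) set" where
  "CL1 T = {u. continuous_on {0<..T} u \<and> set_integrable lborel {0<..T} u}"

definition C1_on :: "real set \<Rightarrow> (real \<Rightarrow> real) set" where
  "C1_on S = {f. \<exists>f'. (\<forall>x\<in>S. (f has_real_derivative f' x) (at x within S)) \<and> continuous_on S f'}"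

text \<open>The Riemann--Liouville integral; at $x = 0$ the domain of integration is empty, which gives
  the extension by $0$.\<close>

definition RL_int :: "real \<Rightarrow> (real \<Rightarrow> real) \<Rightarrow> real \<Rightarrow> real" where
  "RL_int \<gamma> u x = (LBINT r:{0<..<x}. (x - r) powr (\<gamma> - 1) / Gamma \<gamma> * u r)"

definition C_beta :: "real \<Rightarrow> real \<Rightarrow> (real \<Rightarrow> real) set" where
  "C_beta \<beta> T = {u \<in> CL1 T. RL_int (1 - \<beta>) u \<in> C1_on {0<..T}}"

definition C_beta_closed :: "real \<Rightarrow> real \<Rightarrow> (real \<Rightarrow> real) set" where
  "C_beta_closed \<beta> T = {u. continuous_on {0..T} u} \<inter> C_beta \<beta> T"

definition censored_deriv :: "real \<Rightarrow> real \<Rightarrow> (real \<Rightarrow> real) \<Rightarrow> real \<Rightarrow> real" where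
  "censored_deriv \<beta> T u x =
     vector_derivative (RL_int (1 - \<beta>) u) (at x within {0<..T})
     - x powr (-\<beta>) / Gamma (1 - \<beta>) * u x"

definition K_op :: "real \<Rightarrow> (real \<Rightarrow> real) \<Rightarrow> real \<Rightarrow> real" where
  "K_op \<beta> \<psi> x =
     (if x = 0 then \<psi> 0
      else (LBINT r:{0<..<x}.
              (x - r) powr (\<beta> - 1) * r powr (-\<beta>) / (Gamma \<beta> * Gamma (1 - \<beta>)) * \<psi> r))"

definition censored_int :: "real \<Rightarrow> (real \<Rightarrow> real) \<Rightarrow> real \<Rightarrow> real" where
  "censored_int \<beta> g x = (\<Sum>j. (K_op \<beta> ^^ j) (RL_int \<beta> g) x)"

definition solves_linear_ivp ::
    "real \<Rightarrow> real \<Rightarrow> real \<Rightarrow> real \<Rightarrow> (real \<Rightarrow> real) \<Rightarrow> bool" where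
  "solves_linear_ivp \<beta> T lam u0 u \<longleftrightarrow>
     u \<in> C_beta_closed \<beta> T \<and>
     (\<forall>x\<in>{0<..T}. censored_deriv \<beta> T u x = lam * u x) \<and>
     u 0 = u0"

text \<open>The $N$-th term of the explicit series. The factor $x^{\beta N}$ is written as $(x^\beta)^N$
  since it has to be $1$ for $x = 0$ and $N = 0$, whereas \<^term>\<open>(0::real) powr 0\<close> is $0$.\<close>

definition series_term :: "real \<Rightarrow> real \<Rightarrow> real \<Rightarrow> nat \<Rightarrow> real" where
  "series_term \<beta> lam x N =
     lam ^ N * (x powr \<beta>) ^ N *
     (\<Prod>n=1..N. inverse (Gamma (1 + real n * \<beta>) / Gamma (real n * \<beta> + 1 - \<beta>)
                         - 1 / Gamma (1 - \<beta>)))"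

end

theory Submission
  imports Defs "HOL-Real_Asymp.Real_Asymp"
begin

text \<open>
  With $d_n = \Gamma(1+n\beta)/\Gamma(n\beta+1-\beta) - 1/\Gamma(1-\beta)$, log-convexity of
  $\Gamma$ gives $d_n \to \infty$, so $E(z) = \sum_N z^N / (d_1 \cdots d_N)$ is entire. On powers
  of $x$ the operator $\mathcal K$ acts as multiplication by a constant less than $1$, and summing
  a geometric series turns $(I_0^\beta)^N 1$ into $x^{\beta N} / (d_1 \cdots d_N)$. Integrating and
  differentiating termwise shows that $u_0 E(\lambda x^\beta)$ is a solution.

  For uniqueness, apply $J_0^\beta$ to the integrated equation and use the semigroup law: every
  solution satisfies $v = \mathcal K v + \lambda J_0^\beta v$. Let $w$ be the difference of two
  solutions and $U = E(|\lambda| x^\beta) \ge 1$. If $|w|/U$ had a maximum $m > 0$, attained at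
  $x_0$, then $x_0 > 0$, and $y = mU - |w| \ge 0$ would satisfy both $y(x_0) = 0$ and
  $y(x_0) \ge \mathcal K y(x_0) + |\lambda| J_0^\beta y(x_0) > 0$, since $y(0) = m > 0$.
\<close>

subsection \<open>Beta integrals and the Riemann--Liouville semigroup\<close>

text \<open>The Beta integral is first available as a gauge integral. Its integrand is nonnegative,
  hence absolutely integrable, so the value carries over to the Lebesgue integral.\<close>

lemma has_bochner_integral_Beta:
  fixes a b :: real
  assumes "0 < a" "0 < b"
  shows "has_bochner_integral lborel
           (\<lambda>t. indicator {0<..<1} t * ((1 - t) powr (a - 1) * t powr (b - 1))) (Beta a b)"
proof -
  let ?f = "\<lambda>t::real. (1 - t) powr (a - 1) * t powr (b - 1)"
  have hi: "(?f has_integral Beta a b) {0<..<1}"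
    using has_integral_Beta_real[OF assms(2,1)]
    by (simp add: has_integral_Icc_iff_Ioo Beta_commute mult.commute)
  then have "?f absolutely_integrable_on {0<..<1}"
    by (intro nonnegative_absolutely_integrable_1) auto
  then have "integrable lborel (\<lambda>t. indicator {0<..<1} t * ?f t)"
    unfolding set_integrable_def by (subst (asm) integrable_completion) auto
  moreover have "(LBINT t. indicator {0<..<1} t * ?f t) = Beta a b"
  proof -
    have "set_integrable lborel {0<..<1} ?f"
      using calculation by (simp add: set_integrable_def)
    from set_borel_integral_eq_integral(2)[OF this] show ?thesis
      using integral_unique[OF hi] by (simp add: set_lebesgue_integral_def)
  qed
  ultimately show ?thesis by (simp add: has_bochner_integral_iff)
qed

text \<open>The substitution \<open>r = s + h * t\<close> with \<open>h = x - s\<close> leads back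
  to the unit interval; the kernel contributes \<open>h powr (a + b - 2)\<close> and the measure one
  more factor \<open>h\<close>.\<close>

lemma has_bochner_integral_Beta_interval:
  fixes a b s x :: real
  assumes "0 < a" "0 < b" "s < x"
  shows "has_bochner_integral lborel
           (\<lambda>r. indicator {s<..<x} r * ((x - r) powr (a - 1) * (r - s) powr (b - 1)))
           (Beta a b * (x - s) powr (a + b - 1))"
proof -
  define h where "h = x - s"
  have h: "h > 0" "x = s + h" using assms by (auto simp: h_def)
  have "has_bochner_integral lborel
          (\<lambda>t. h powr (a + b - 2) * (indicator {0<..<1} t * ((1 - t) powr (a - 1) * t powr (b - 1))))
          (h powr (a + b - 2) * Beta a b)"
    by (intro has_bochner_integral_mult_right has_bochner_integral_Beta assms)
  also have "(\<lambda>t. h powr (a + b - 2) * (indicator {0<..<1} t * ((1 - t) powr (a - 1) * t powr (b - 1))))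
     = (\<lambda>t. indicator {s<..<x} (s + h * t)
              * ((x - (s + h * t)) powr (a - 1) * ((s + h * t) - s) powr (b - 1)))"
  proof
    fix t
    have "x - (s + h * t) = h * (1 - t)" using h by (simp add: algebra_simps)
    moreover have "h powr (a + b - 2) = h powr (a - 1) * h powr (b - 1)"
      by (simp flip: powr_add)
    ultimately show "h powr (a + b - 2) * (indicator {0<..<1} t * ((1 - t) powr (a - 1) * t powr (b - 1)))
       = indicator {s<..<x} (s + h * t)
              * ((x - (s + h * t)) powr (a - 1) * ((s + h * t) - s) powr (b - 1))"
      using h by (auto simp: indicator_def powr_mult zero_less_mult_iff)
  qed
  also have "h powr (a + b - 2) * Beta a b = (Beta a b * h powr (a + b - 1)) /\<^sub>R \<bar>h\<bar>"
    using h by (simp add: powr_diff field_simps power2_eq_square powr_numeral)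
  finally show ?thesis
    using h(1) by (subst lborel_has_bochner_integral_real_affine_iff[where c = h and t = s])
      (simp_all add: h_def)
qed

text \<open>A continuous \<open>w\<close> is bounded on the compact interval, so a multiple of the
  Beta weight dominates the integrand.\<close>

lemma set_integrable_beta_weight:
  fixes a b x T :: real and w :: "real \<Rightarrow> real"
  assumes "0 < a" "0 < b" "0 < x" "x \<le> T" "continuous_on {0..T} w"
  shows "set_integrable lborel {0<..<x} (\<lambda>r. (x - r) powr (a - 1) * r powr (b - 1) * w r)"
proof -
  obtain B where B: "\<And>r. r \<in> {0..T} \<Longrightarrow> norm (w r) \<le> B"
    using compact_continuous_image[OF assms(5) compact_Icc]
    by (metis bounded_iff compact_imp_bounded imageI)
  have w: "(\<lambda>r. indicator {0<..<x} r * w r) \<in> borel_measurable lborel"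
    using borel_measurable_continuous_on_indicator[of "{0<..<x}" w]
      continuous_on_subset[OF assms(5), of "{0<..<x}"] assms by force
  have 1: "integrable lborel (\<lambda>r. B * (indicator {0<..<x} r * ((x - r) powr (a - 1) * (r - 0) powr (b - 1))))"
    using has_bochner_integral_Beta_interval[OF assms(1-3)]
    by (intro integrable_mult_right) (auto simp: has_bochner_integral_iff)
  \<comment> \<open>Nothing is known about \<open>w\<close> outside \<open>{0..T}\<close>. The
    indicator is therefore grouped with \<open>w\<close>, as only this product is known to be
    measurable.\<close>
  have "integrable lborel (\<lambda>r. ((x - r) powr (a - 1) * r powr (b - 1)) * (indicator {0<..<x} r * w r))"
  proof (rule Bochner_Integration.integrable_bound[OF 1])
    show "AE r in lborel. norm (((x - r) powr (a - 1) * r powr (b - 1)) * (indicator {0<..<x} r * w r))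
       \<le> norm (B * (indicator {0<..<x} r * ((x - r) powr (a - 1) * (r - 0) powr (b - 1))))"
    proof (intro AE_I2)
      fix r
      have "\<bar>w r\<bar> \<le> \<bar>B\<bar>" if "0 < r" "r < x" using B[of r] assms that by auto
      then show "norm (((x - r) powr (a - 1) * r powr (b - 1)) * (indicator {0<..<x} r * w r))
       \<le> norm (B * (indicator {0<..<x} r * ((x - r) powr (a - 1) * (r - 0) powr (b - 1))))"
        by (auto simp: indicator_def abs_mult mult_right_mono mult.commute[of _ "\<bar>w r\<bar>"])
    qed
  qed (use w in measurable)
  then show ?thesis
    unfolding set_integrable_def by (simp add: mult_ac)
qed

text \<open>The substitution $r = xt$ moves the dependence on $x$ out of the singular kernel, which makes
  continuity in $x$ a matter of dominated convergence.\<close>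

definition beta_average :: "real \<Rightarrow> real \<Rightarrow> (real \<Rightarrow> real) \<Rightarrow> real \<Rightarrow> real" where
  "beta_average a b w x = (LBINT t:{0<..<1}. (1 - t) powr (a - 1) * t powr (b - 1) * w (x * t))"

lemma set_integral_beta_weight:
  fixes a b x :: real
  assumes "0 < x"
  shows "(LBINT r:{0<..<x}. (x - r) powr (a - 1) * r powr (b - 1) * w r)
           = x powr (a + b - 1) * beta_average a b w x"
proof -
  let ?f = "\<lambda>r. indicator {0<..<x} r * ((x - r) powr (a - 1) * r powr (b - 1) * w r)"
  have "(LBINT r. ?f r) = \<bar>x\<bar> *\<^sub>R (LBINT t. ?f (0 + x * t))"
    using assms by (intro lborel_integral_real_affine) auto
  also have "(\<lambda>t. ?f (0 + x * t)) = (\<lambda>t. x powr (a + b - 2) * (indicator {0<..<1} t *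
              ((1 - t) powr (a - 1) * t powr (b - 1) * w (x * t))))"
  proof
    fix t
    have "x - x * t = x * (1 - t)" by (simp add: algebra_simps)
    moreover have "x powr (a + b - 2) = x powr (a - 1) * x powr (b - 1)"
      by (simp flip: powr_add)
    ultimately show "?f (0 + x * t) = x powr (a + b - 2) * (indicator {0<..<1} t *
              ((1 - t) powr (a - 1) * t powr (b - 1) * w (x * t)))"
      using assms by (auto simp: indicator_def powr_mult zero_less_mult_iff)
  qed
  also have "\<bar>x\<bar> *\<^sub>R (LBINT t. x powr (a + b - 2) * (indicator {0<..<1} t *
              ((1 - t) powr (a - 1) * t powr (b - 1) * w (x * t))))
           = x powr (a + b - 1) * beta_average a b w x"
  proof -
    have "x * x powr (a + b - 2) = x powr (a + b - 1)"
      using assms powr_add[of x 1 "a + b - 2"] by simp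
    then show ?thesis
      using assms
      by (subst integral_mult_right_zero)
        (simp add: beta_average_def set_lebesgue_integral_def flip: mult.assoc)
  qed
  finally show ?thesis by (simp add: set_lebesgue_integral_def)
qed

lemma continuous_on_beta_average:
  fixes a b T :: real
  assumes "0 < a" "0 < b" "continuous_on {0..T} w"
  shows "continuous_on {0..T} (beta_average a b w)"
  unfolding continuous_on_sequentially
proof (intro ballI allI impI)
  fix X :: "nat \<Rightarrow> real" and x
  assume x: "x \<in> {0..T}" and "(\<forall>n. X n \<in> {0..T}) \<and> X \<longlonglongrightarrow> x"
  then have X: "\<And>n. X n \<in> {0..T}" "X \<longlonglongrightarrow> x" by auto
  obtain B where B: "\<And>r. r \<in> {0..T} \<Longrightarrow> norm (w r) \<le> B"
    using compact_continuous_image[OF assms(3) compact_Icc]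
    by (metis bounded_iff compact_imp_bounded imageI)
  let ?k = "\<lambda>t. indicator {0<..<1} t * ((1 - t) powr (a - 1) * t powr (b - 1))"
  have in_T: "y * t \<in> {0..T}" if "y \<in> {0..T}" "0 < t" "t < 1" for y t :: real
  proof -
    have "y * t \<le> y * 1" using that by (intro mult_left_mono) auto
    then show ?thesis using that by auto
  qed
  have meas: "(\<lambda>t. ?k t * w (y * t)) \<in> borel_measurable lborel" if "y \<in> {0..T}" for y
  proof -
    have "continuous_on {0<..<1} (\<lambda>t. w (y * t))"
      by (rule continuous_on_compose2[OF assms(3)]) (use in_T[OF that] in \<open>auto intro!: continuous_intros\<close>)
    then have [measurable]: "(\<lambda>t. indicator {0<..<1} t * w (y * t)) \<in> borel_measurable borel"
      using borel_measurable_continuous_on_indicator[of "{0<..<1}" "\<lambda>t. w (y * t)"] by auto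
    have "(\<lambda>t. ((1 - t) powr (a - 1) * t powr (b - 1)) * (indicator {0<..<1} t * w (y * t)))
        \<in> borel_measurable borel" by measurable
    then show ?thesis by (simp add: mult_ac)
  qed
  \<comment> \<open>The majorant is independent of \<open>n\<close> because all points
    \<open>X n * t\<close> stay in \<open>{0..T}\<close>, where \<open>B\<close> bounds
    \<open>w\<close>. The endpoint 0 needs no separate treatment.\<close>
  have "(\<lambda>n. LBINT t. ?k t * w (X n * t)) \<longlonglongrightarrow> (LBINT t. ?k t * w (x * t))"
  proof (rule integral_dominated_convergence[where w = "\<lambda>t. B * ?k t"])
    show "integrable lborel (\<lambda>t. B * ?k t)"
      using has_bochner_integral_Beta[OF assms(1,2)]
      by (intro integrable_mult_right) (auto simp: has_bochner_integral_iff)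
    show "AE t in lborel. (\<lambda>n. ?k t * w (X n * t)) \<longlonglongrightarrow> ?k t * w (x * t)"
    proof (rule AE_I2)
      fix t :: real
      show "(\<lambda>n. ?k t * w (X n * t)) \<longlonglongrightarrow> ?k t * w (x * t)"
      proof (cases "0 < t \<and> t < 1")
        case True
        then show ?thesis
          by (intro tendsto_mult_left continuous_on_tendsto_compose[OF assms(3)] tendsto_mult_right X)
            (use in_T X x True in \<open>auto intro!: always_eventually\<close>)
      qed (auto simp: indicator_def)
    qed
    show "AE t in lborel. norm (?k t * w (X n * t)) \<le> B * ?k t" for n
    proof (rule AE_I2)
      fix t :: real
      show "norm (?k t * w (X n * t)) \<le> B * ?k t"
        using B[of "X n * t"] in_T[OF X(1), of t n]
        by (auto simp: indicator_def abs_mult mult_left_mono mult.commute[of B])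
    qed
  qed (use meas X x in auto)
  then show "(beta_average a b w \<circ> X) \<longlonglongrightarrow> beta_average a b w x"
    by (simp add: beta_average_def set_lebesgue_integral_def o_def mult_ac)
qed

text \<open>Fubini on the triangle \<open>0 < s < r < x\<close>: the inner integral over
  \<open>r\<close> is a Beta integral. Since \<open>1 \<le> a + b\<close>, the resulting factor
  \<open>(x - s) powr (a + b - 1)\<close> is bounded by \<open>x powr (a + b - 1)\<close>, so
  integrability of \<open>f\<close> suffices and the law holds at the given point, not just almost
  everywhere.\<close>

lemma RL_int_RL_int:
  fixes a b x :: real
  assumes a: "0 < a" and b: "0 < b" and ab: "1 \<le> a + b" and x: "0 < x"
    and f: "set_integrable lborel {0<..<x} f"
  shows "RL_int a (RL_int b f) x = RL_int (a + b) f x"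
proof -
  have nz: "Gamma a \<noteq> 0" "Gamma b \<noteq> 0"
    using Gamma_real_pos[OF a] Gamma_real_pos[OF b] by (metis less_irrefl)+
  define g where "g s = indicator {0<..<x} s * f s" for s
  have g: "integrable lborel g" using f by (simp add: g_def[abs_def] set_integrable_def)
  then have [measurable]: "g \<in> borel_measurable borel" by auto
  let ?k = "\<lambda>s r. indicator {s<..<x} r * ((x - r) powr (a - 1) * (r - s) powr (b - 1))"
  define H where "H = (\<lambda>(s, r). ?k s r * g s)"
  \<comment> \<open>Writing the triangle as a case distinction on the two projections makes joint
    measurability immediate.\<close>
  have H_meas: "H \<in> borel_measurable (lborel \<Otimes>\<^sub>M lborel)"
  proof -
    have "H = (\<lambda>p. (if fst p < snd p \<and> snd p < x
        then (x - snd p) powr (a - 1) * (snd p - fst p) powr (b - 1) else 0) * g (fst p))"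
      by (auto simp: H_def fun_eq_iff indicator_def)
    also have "\<dots> \<in> borel_measurable (borel \<Otimes>\<^sub>M borel)" by measurable
    finally show ?thesis by (simp add: lborel_prod borel_prod)
  qed
  have k: "has_bochner_integral lborel (?k s) (Beta a b * (x - s) powr (a + b - 1))" if "s < x" for s
    by (rule has_bochner_integral_Beta_interval[OF a b that])
  \<comment> \<open>The Beta formula is available only for \<open>s < x\<close>; for all other
    \<open>s\<close> both sides of the inner identities vanish together with
    \<open>g s\<close>.\<close>
  have g0: "g s = 0" if "\<not> s < x" for s using that by (simp add: g_def)
  have inner: "integrable lborel (\<lambda>r. ?k s r * g s)"
    "(LBINT r. ?k s r * g s) = Beta a b * ((x - s) powr (a + b - 1) * g s)"
    "(LBINT r. norm (?k s r * g s)) = Beta a b * ((x - s) powr (a + b - 1) * norm (g s))" for s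
  proof -
    have "integrable lborel (\<lambda>r. ?k s r * g s)
      \<and> (LBINT r. ?k s r * g s) = Beta a b * ((x - s) powr (a + b - 1) * g s)
      \<and> (LBINT r. norm (?k s r * g s)) = Beta a b * ((x - s) powr (a + b - 1) * norm (g s))"
    proof (cases "s < x")
      case True
      have "(\<lambda>r. norm (?k s r * g s)) = (\<lambda>r. ?k s r * norm (g s))"
        by (auto simp: abs_mult)
      then show ?thesis using k[OF True] by (auto simp: has_bochner_integral_iff)
    qed (simp add: g0)
    then show "integrable lborel (\<lambda>r. ?k s r * g s)"
    "(LBINT r. ?k s r * g s) = Beta a b * ((x - s) powr (a + b - 1) * g s)"
    "(LBINT r. norm (?k s r * g s)) = Beta a b * ((x - s) powr (a + b - 1) * norm (g s))"
      by blast+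
  qed
  have outer: "integrable lborel (\<lambda>s. (x - s) powr (a + b - 1) * norm (g s))"
  proof (rule Bochner_Integration.integrable_bound)
    show "integrable lborel (\<lambda>s. x powr (a + b - 1) * norm (g s))" using g by auto
    show "AE s in lborel. norm ((x - s) powr (a + b - 1) * norm (g s))
        \<le> norm (x powr (a + b - 1) * norm (g s))"
    proof (rule AE_I2)
      fix s
      show "norm ((x - s) powr (a + b - 1) * norm (g s)) \<le> norm (x powr (a + b - 1) * norm (g s))"
        using ab by (auto simp: g_def indicator_def abs_mult intro!: mult_right_mono powr_mono2)
    qed
  qed measurable
  have "integrable (lborel \<Otimes>\<^sub>M lborel) H"
  proof (rule lborel_pair.Fubini_integrable[OF H_meas])
    show "integrable lborel (\<lambda>s. LBINT r. norm (H (s, r)))"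
      using outer by (simp add: H_def inner(3) del: real_norm_def)
    show "AE s in lborel. integrable lborel (\<lambda>r. H (s, r))"
      by (intro AE_I2) (simp only: H_def prod.case inner(1))
  qed
  then have "(LBINT r. LBINT s. H (s, r)) = (LBINT s. LBINT r. H (s, r))"
    using lborel_pair.Fubini_integral[of "\<lambda>s r. H (s, r)"] by simp
  also have "\<dots> = Beta a b * (LBINT s. (x - s) powr (a + b - 1) * g s)"
    by (simp only: H_def prod.case inner(2) integral_mult_right_zero)
  also have "\<dots> = Gamma a * Gamma b * RL_int (a + b) f x"
  proof -
    have "Gamma (a + b) \<noteq> 0" by (metis a b add_pos_pos Gamma_real_pos less_irrefl)
    then show ?thesis
      by (simp add: RL_int_def set_lebesgue_integral_def g_def Beta_def mult_ac
          flip: integral_mult_right_zero)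
  qed
  also have "(LBINT r. LBINT s. H (s, r)) = Gamma a * Gamma b * RL_int a (RL_int b f) x"
  proof -
    have "(LBINT s. H (s, r)) = Gamma a * Gamma b *
       (indicator {0<..<x} r * ((x - r) powr (a - 1) / Gamma a * RL_int b f r))" for r
    proof -
      have "(\<lambda>s. H (s, r)) = (\<lambda>s. (indicator {0<..<x} r * (x - r) powr (a - 1) * Gamma b) *
             (indicator {0<..<r} s * ((r - s) powr (b - 1) / Gamma b * f s)))"
        using nz by (auto simp: H_def g_def indicator_def)
      then show ?thesis
        using nz by (simp add: RL_int_def set_lebesgue_integral_def)
    qed
    then show ?thesis by (simp add: RL_int_def set_lebesgue_integral_def)
  qed
  finally show ?thesis
    using nz by simp
qed

subsection \<open>The coefficients of the solution\<close>

text \<open>This is the number by which the censored derivative acts on powers: it sends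
  \<open>x powr q\<close> to
  \<open>censored_factor \<beta> q * x powr (q - \<beta>)\<close>.\<close>

definition censored_factor :: "real \<Rightarrow> real \<Rightarrow> real" where
  "censored_factor \<beta> q = Gamma (1 + q) / Gamma (q + 1 - \<beta>) - 1 / Gamma (1 - \<beta>)"

text \<open>The digamma function is strictly increasing, so the logarithm of
  \<open>Gamma (1 + q) / Gamma (q + 1 - \<beta>)\<close> strictly increases in \<open>q\<close>. At
  \<open>q = 0\<close> this quotient is exactly the subtracted constant
  \<open>1 / Gamma (1 - \<beta>)\<close>.\<close>

lemma censored_factor_pos:
  assumes "0 < \<beta>" "\<beta> < 1" "0 < q"
  shows "0 < censored_factor \<beta> q"
proof -
  have "ln_Gamma (1 + 0) - ln_Gamma (0 + 1 - \<beta>) < ln_Gamma (1 + q) - ln_Gamma (q + 1 - \<beta>)"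
  proof (rule DERIV_pos_imp_increasing[where f = "\<lambda>q. ln_Gamma (1 + q) - ln_Gamma (q + 1 - \<beta>)"])
    fix t :: real assume "0 \<le> t"
    moreover from this have "Digamma (t + 1 - \<beta>) < Digamma (1 + t)"
      using assms by (intro Digamma_real_strict_mono) auto
    ultimately show "\<exists>y. ((\<lambda>q. ln_Gamma (1 + q) - ln_Gamma (q + 1 - \<beta>)) has_real_derivative y) (at t) \<and> 0 < y"
      using assms by (intro exI[of _ "Digamma (1 + t) - Digamma (t + 1 - \<beta>)"])
        (auto intro!: derivative_eq_intros)
  qed (use assms in auto)
  then have "ln_Gamma (q + 1 - \<beta>) - ln_Gamma (1 - \<beta>) < ln_Gamma (1 + q)"
    using Gamma_real_pos_exp[of 1] by simp
  then have "exp (ln_Gamma (q + 1 - \<beta>)) / exp (ln_Gamma (1 - \<beta>)) < exp (ln_Gamma (1 + q))"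
    by (simp flip: exp_diff)
  then have "Gamma (q + 1 - \<beta>) / Gamma (1 - \<beta>) < Gamma (1 + q)"
    using assms by (simp add: Gamma_real_pos_exp)
  then show ?thesis
    using assms Gamma_real_pos[of "q + 1 - \<beta>"] Gamma_real_pos[of "1 - \<beta>"]
    by (simp add: censored_factor_def field_simps)
qed

text \<open>Log-convexity of \<open>Gamma\<close> between \<open>q\<close> and \<open>q + 1\<close>,
  at the intermediate point \<open>q + 1 - \<beta>\<close>, combined with
  \<open>Gamma (q + 1) = q * Gamma q\<close>. The bound makes the factors tend to infinity along
  \<open>q = n * \<beta>\<close>.\<close>

lemma censored_factor_ge:
  assumes "0 < \<beta>" "\<beta> < 1" "0 < q"
  shows "q powr \<beta> - 1 / Gamma (1 - \<beta>) \<le> censored_factor \<beta> q"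
proof -
  have pos: "Gamma q > 0" "Gamma (q + 1) > 0" "Gamma (q + 1 - \<beta>) > 0"
    using assms by (auto intro!: Gamma_real_pos)
  have "(ln \<circ> Gamma) ((1 - (1 - \<beta>)) *\<^sub>R q + (1 - \<beta>) *\<^sub>R (q + 1))
     \<le> (1 - (1 - \<beta>)) * (ln \<circ> Gamma) q + (1 - \<beta>) * (ln \<circ> Gamma) (q + 1)"
    by (rule convex_onD[OF log_convex_Gamma_real]) (use assms in auto)
  also have "(1 - (1 - \<beta>)) *\<^sub>R q + (1 - \<beta>) *\<^sub>R (q + 1) = q + 1 - \<beta>"
    by (simp add: algebra_simps)
  also have "(1 - (1 - \<beta>)) * (ln \<circ> Gamma) q + (1 - \<beta>) * (ln \<circ> Gamma) (q + 1)
      = ln (Gamma (q + 1)) - \<beta> * ln q"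
  proof -
    have "q \<notin> \<int>\<^sub>\<le>\<^sub>0" using assms by (auto elim!: nonpos_Ints_cases)
    then have "ln (Gamma (q + 1)) = ln q + ln (Gamma q)"
      using Gamma_plus1[of q] ln_mult_pos[OF assms(3) pos(1)] by simp
    then show ?thesis by (simp add: algebra_simps)
  qed
  finally have "exp (\<beta> * ln q) \<le> exp (ln (Gamma (q + 1)) - ln (Gamma (q + 1 - \<beta>)))"
    by simp
  then have "q powr \<beta> \<le> Gamma (q + 1) / Gamma (q + 1 - \<beta>)"
    using assms pos by (simp add: exp_diff powr_def)
  then show ?thesis by (simp add: censored_factor_def add.commute)
qed

definition censored_coeff :: "real \<Rightarrow> nat \<Rightarrow> real" where
  "censored_coeff \<beta> N = (\<Prod>n=1..N. inverse (censored_factor \<beta> (real n * \<beta>)))"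

lemma series_term_eq:
  "series_term \<beta> lam x N = censored_coeff \<beta> N * (lam * x powr \<beta>) ^ N"
  by (simp add: series_term_def censored_coeff_def censored_factor_def power_mult_distrib)

lemma censored_coeff_0 [simp]: "censored_coeff \<beta> 0 = 1"
  by (simp add: censored_coeff_def)

lemma censored_coeff_Suc:
  "censored_coeff \<beta> (Suc N) = censored_coeff \<beta> N / censored_factor \<beta> (real (Suc N) * \<beta>)"
  by (simp add: censored_coeff_def prod.nat_ivl_Suc' divide_inverse mult.commute)

lemma censored_coeff_pos:
  assumes "0 < \<beta>" "\<beta> < 1"
  shows "0 < censored_coeff \<beta> N"
  unfolding censored_coeff_def
  by (intro prod_pos ballI) (use assms in \<open>auto intro!: censored_factor_pos\<close>)

lemma summable_censored_series:
  assumes \<beta>: "0 < \<beta>" "\<beta> < 1"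
  shows "summable (\<lambda>N. censored_coeff \<beta> N * z ^ N)"
proof -
  have "filterlim (\<lambda>N. (real (Suc N) * \<beta>) powr \<beta> - 1 / Gamma (1 - \<beta>)) at_top sequentially"
    using \<beta> by real_asymp
  then have "\<forall>\<^sub>F N in sequentially. 2 * \<bar>z\<bar> + 1 \<le> (real (Suc N) * \<beta>) powr \<beta> - 1 / Gamma (1 - \<beta>)"
    by (auto simp: filterlim_at_top)
  \<comment> \<open>The bound \<open>2 * |z| + 1\<close> forces the ratio \<open>|z| / d\<close> of
    consecutive terms below 1/2; the summand 1 keeps \<open>d\<close> positive even for
    \<open>z = 0\<close>.\<close>
  then obtain M where M: "\<And>N. M \<le> N \<Longrightarrow>
      2 * \<bar>z\<bar> + 1 \<le> (real (Suc N) * \<beta>) powr \<beta> - 1 / Gamma (1 - \<beta>)"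
    by (auto simp: eventually_sequentially)
  show ?thesis
  proof (rule summable_ratio_test[where c = "1/2" and N = M])
    fix N assume "M \<le> N"
    define d where "d = censored_factor \<beta> (real (Suc N) * \<beta>)"
    have "real (Suc N) * \<beta> > 0" using \<beta> by simp
    from order_trans[OF M[OF \<open>M \<le> N\<close>] censored_factor_ge[OF \<beta> this]]
    have d: "2 * \<bar>z\<bar> + 1 \<le> d" unfolding d_def .
    then have "\<bar>z\<bar> / d \<le> 1 / 2" by (simp add: field_simps)
    then have "\<bar>censored_coeff \<beta> N * z ^ N\<bar> * (\<bar>z\<bar> / d) \<le> \<bar>censored_coeff \<beta> N * z ^ N\<bar> * (1 / 2)"
      by (intro mult_left_mono) auto
    moreover have "\<bar>d\<bar> = d" "censored_coeff \<beta> (Suc N) = censored_coeff \<beta> N / d"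
      using d by (simp_all add: censored_coeff_Suc d_def)
    ultimately show "norm (censored_coeff \<beta> (Suc N) * z ^ Suc N) \<le> 1 / 2 * norm (censored_coeff \<beta> N * z ^ N)"
      by (simp add: abs_mult power_abs mult_ac)
  qed simp
qed

text \<open>The entire function \<open>E\<close> of the overview. Without the subtracted
  \<open>1 / Gamma (1 - \<beta>)\<close> in each factor, the products would telescope and give the
  Mittag-Leffler function.\<close>

definition censored_exp :: "real \<Rightarrow> real \<Rightarrow> real" where
  "censored_exp \<beta> z = (\<Sum>N. censored_coeff \<beta> N * z ^ N)"

lemma sums_censored_exp:
  assumes "0 < \<beta>" "\<beta> < 1"
  shows "(\<lambda>N. censored_coeff \<beta> N * z ^ N) sums censored_exp \<beta> z"
  unfolding censored_exp_def by (rule summable_sums summable_censored_series assms)+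

lemma continuous_on_censored_exp:
  assumes "0 < \<beta>" "\<beta> < 1"
  shows "continuous_on S (censored_exp \<beta>)"
proof -
  have "isCont (\<lambda>z. \<Sum>N. censored_coeff \<beta> N * z ^ N) z" for z
    by (rule DERIV_isCont[OF termdiffs_strong_converges_everywhere]) (rule summable_censored_series assms)+
  then show ?thesis
    by (intro continuous_at_imp_continuous_on) (simp add: censored_exp_def[abs_def])
qed

lemma censored_exp_0: "censored_exp \<beta> 0 = 1"
  by (simp add: censored_exp_def powser_zero)

text \<open>All terms are nonnegative and the constant term is 1. This allows division by the
  comparison function in the uniqueness proof.\<close>

lemma censored_exp_ge_1:
  assumes "0 < \<beta>" "\<beta> < 1" "0 \<le> z"
  shows "1 \<le> censored_exp \<beta> z"
  using sum_le_suminf[OF summable_censored_series[OF assms(1,2)], of "{0}" z]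
    censored_coeff_pos[OF assms(1,2)] assms(3)
  by (simp add: censored_exp_def less_imp_le)

subsection \<open>Existence\<close>

lemma RL_int_powr:
  assumes "0 < \<gamma>" "-1 < q" "0 < x" and f: "\<And>r. 0 < r \<Longrightarrow> r < x \<Longrightarrow> f r = C * r powr q"
  shows "RL_int \<gamma> f x = C * (Gamma (q + 1) / Gamma (q + 1 + \<gamma>)) * x powr (q + \<gamma>)"
proof -
  let ?k = "\<lambda>r. indicator {0<..<x} r * ((x - r) powr (\<gamma> - 1) * (r - 0) powr (q + 1 - 1))"
  have "RL_int \<gamma> f x = (LBINT r. (C / Gamma \<gamma>) * ?k r)"
    unfolding RL_int_def set_lebesgue_integral_def
    by (rule Bochner_Integration.integral_cong) (auto simp: f indicator_def)
  also have "\<dots> = (C / Gamma \<gamma>) * (Beta \<gamma> (q + 1) * (x - 0) powr (\<gamma> + (q + 1) - 1))"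
    using has_bochner_integral_Beta_interval[of \<gamma> "q + 1" 0 x] assms
    by (subst integral_mult_right_zero) (simp add: has_bochner_integral_iff)
  also have "\<dots> = C * (Gamma (q + 1) / Gamma (q + 1 + \<gamma>)) * x powr (q + \<gamma>)"
    using Gamma_real_pos[OF assms(1)] by (simp add: Beta_def field_simps add_ac)
  finally show ?thesis .
qed

text \<open>The weight \<open>r powr (-\<beta>)\<close> turns this into a Riemann-Liouville integral
  of \<open>r powr (q - \<beta>)\<close>, with \<open>q - \<beta> > -1\<close>. At
  \<open>x = 0\<close> both sides vanish because \<open>f 0 = C * 0 powr q = 0\<close>.\<close>

lemma K_op_powr:
  assumes "0 < \<beta>" "\<beta> < 1" "0 < q" "0 \<le> x"
    and f: "\<And>r. 0 \<le> r \<Longrightarrow> r \<le> x \<Longrightarrow> f r = C * r powr q"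
  shows "K_op \<beta> f x = C * (Gamma (q + 1 - \<beta>) / (Gamma (1 - \<beta>) * Gamma (q + 1))) * x powr q"
proof (cases "x = 0")
  case False
  then have "0 < x" using assms by simp
  have "K_op \<beta> f x = RL_int \<beta> (\<lambda>r. (C / Gamma (1 - \<beta>)) * r powr (q - \<beta>)) x"
    unfolding K_op_def RL_int_def set_lebesgue_integral_def if_not_P[OF False]
    by (intro Bochner_Integration.integral_cong)
      (auto simp: f indicator_def diff_conv_add_uminus[of q \<beta>] powr_add simp del: add_uminus_conv_diff)
  also have "\<dots> = (C / Gamma (1 - \<beta>)) * (Gamma (q - \<beta> + 1) / Gamma (q - \<beta> + 1 + \<beta>)) * x powr (q - \<beta> + \<beta>)"
    by (rule RL_int_powr) (use assms \<open>0 < x\<close> in auto)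
  finally show ?thesis by (simp add: algebra_simps)
qed (use f[of 0] assms in \<open>simp add: K_op_def\<close>)

text \<open>The first integration yields \<open>C * \<rho> * x powr (p + \<beta>)\<close>, and each
  application of \<open>K_op\<close> multiplies by \<open>\<kappa> < 1\<close>. The geometric series
  has sum \<open>1 / (1 - \<kappa>)\<close>, and \<open>1 - \<kappa> = \<rho> * censored_factor
  \<beta> (p + \<beta>)\<close>. The shape of \<open>f\<close> is prescribed only for
  \<open>r > 0\<close>, so that the constant 1 is covered with \<open>p = 0\<close> although
  \<open>0 powr 0 = 0\<close>.\<close>

lemma censored_int_powr:
  assumes \<beta>: "0 < \<beta>" "\<beta> < 1" and "0 \<le> p" "0 \<le> x"
    and f: "\<And>r. 0 < r \<Longrightarrow> f r = C * r powr p"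
  shows "censored_int \<beta> f x = C / censored_factor \<beta> (p + \<beta>) * x powr (p + \<beta>)"
proof -
  define q where "q = p + \<beta>"
  define \<kappa> where "\<kappa> = Gamma (q + 1 - \<beta>) / (Gamma (1 - \<beta>) * Gamma (q + 1))"
  define \<rho> where "\<rho> = Gamma (q + 1 - \<beta>) / Gamma (q + 1)"
  have "0 < q" using assms by (simp add: q_def)
  have pos: "0 < Gamma (q + 1 - \<beta>)" "0 < Gamma (1 - \<beta>)" "0 < Gamma (q + 1)"
    using \<beta> \<open>0 < q\<close> by (auto intro!: Gamma_real_pos)
  have d: "0 < censored_factor \<beta> q" using \<beta> \<open>0 < q\<close> by (rule censored_factor_pos)
  have \<kappa>: "1 - \<kappa> = \<rho> * censored_factor \<beta> q" "0 \<le> \<kappa>" "0 < \<rho>"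
    using pos by (auto simp: \<kappa>_def \<rho>_def censored_factor_def field_simps)
  then have "\<kappa> < 1" using d by (smt (verit) mult_pos_pos)
  have iter: "(K_op \<beta> ^^ j) (RL_int \<beta> f) y = C * \<rho> * \<kappa> ^ j * y powr q" if "0 \<le> y" for j y
    using that
  proof (induction j arbitrary: y)
    case 0
    show ?case
    proof (cases "y = 0")
      case False
      then have "RL_int \<beta> f y = C * (Gamma (p + 1) / Gamma (p + 1 + \<beta>)) * y powr (p + \<beta>)"
        using assms 0 by (intro RL_int_powr f) auto
      then show ?thesis by (simp add: \<rho>_def q_def algebra_simps)
    qed (simp add: RL_int_def set_lebesgue_integral_def)
  next
    case (Suc j)
    have "K_op \<beta> ((K_op \<beta> ^^ j) (RL_int \<beta> f)) y = C * \<rho> * \<kappa> ^ j * \<kappa> * y powr q"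
      unfolding \<kappa>_def by (rule K_op_powr) (use \<beta> \<open>0 < q\<close> Suc in \<open>auto simp: \<kappa>_def\<close>)
    then show ?case by (simp add: mult_ac)
  qed
  have "(\<lambda>j. C * \<rho> * x powr q * \<kappa> ^ j) sums (C * \<rho> * x powr q * (1 / (1 - \<kappa>)))"
    using \<kappa> \<open>\<kappa> < 1\<close> by (intro sums_mult geometric_sums) auto
  then have "(\<lambda>j. (K_op \<beta> ^^ j) (RL_int \<beta> f) x) sums (C * \<rho> * x powr q * (1 / (1 - \<kappa>)))"
    using iter[OF \<open>0 \<le> x\<close>] by (simp add: mult_ac)
  then have "censored_int \<beta> f x = C * \<rho> * x powr q * (1 / (1 - \<kappa>))"
    by (simp add: censored_int_def sums_iff)
  then show ?thesis using \<kappa> d by (simp add: q_def)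
qed

lemma censored_int_funpow_1:
  assumes \<beta>: "0 < \<beta>" "\<beta> < 1" and "0 \<le> x"
  shows "(censored_int \<beta> ^^ N) (\<lambda>_. 1) x = censored_coeff \<beta> N * (x powr \<beta>) ^ N"
  using \<open>0 \<le> x\<close>
proof (induction N arbitrary: x)
  case (Suc N)
  have "(censored_int \<beta> ^^ Suc N) (\<lambda>_. 1) x
      = censored_coeff \<beta> N / censored_factor \<beta> (real N * \<beta> + \<beta>) * x powr (real N * \<beta> + \<beta>)"
    unfolding funpow.simps o_def
    by (rule censored_int_powr) (use \<beta> Suc in \<open>auto simp: powr_power mult.commute\<close>)
  also have "\<dots> = censored_coeff \<beta> (Suc N) * (x powr \<beta>) ^ Suc N"
    unfolding censored_coeff_Suc
    by (cases "x = 0") (simp, subst powr_power, auto simp: algebra_simps)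
  finally show ?case .
qed simp

section \<open>Termwise integration and differentiation of the series\<close>

lemma continuous_on_censored_exp_powr:
  assumes "0 < \<beta>" "\<beta> < 1"
  shows "continuous_on {0..T} (\<lambda>x. censored_exp \<beta> (lam * x powr \<beta>))"
  by (rule continuous_on_compose2[OF continuous_on_censored_exp[OF assms, of UNIV]])
    (use assms in \<open>auto intro!: continuous_intros continuous_on_powr'\<close>)

text \<open>Writing $z = \lambda x^\beta$, the function $x^{1-\beta} \sum_N r_N z^N$ with $r_N$ the
  \<open>RL_coeff\<close> is the Riemann--Liouville integral of the solution, and $x^{-\beta} \sum_N e_N z^N$
  with $e_N$ the \<open>deriv_coeff\<close> is its derivative.\<close>

definition deriv_coeff :: "real \<Rightarrow> nat \<Rightarrow> real" where
  "deriv_coeff \<beta> N = censored_coeff \<beta> N * (Gamma (1 + real N * \<beta>) / Gamma (real N * \<beta> + 1 - \<beta>))"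

definition RL_coeff :: "real \<Rightarrow> nat \<Rightarrow> real" where
  "RL_coeff \<beta> N = deriv_coeff \<beta> N / (real N * \<beta> + 1 - \<beta>)"

lemma deriv_coeff_nonneg:
  assumes "0 < \<beta>" "\<beta> < 1"
  shows "0 \<le> deriv_coeff \<beta> N"
proof -
  have "0 < Gamma (1 + real N * \<beta>)" "0 < Gamma (real N * \<beta> + 1 - \<beta>)"
    using assms by (auto intro!: Gamma_real_pos add_nonneg_pos simp: add_diff_eq[symmetric] add_pos_nonneg)
  then show ?thesis using censored_coeff_pos[OF assms, of N] by (simp add: deriv_coeff_def)
qed

text \<open>The differential equation at the level of coefficients: the Gamma quotient is the factor
  \<open>d\<close> plus \<open>1 / Gamma (1 - \<beta>)\<close>, and multiplication by
  \<open>d\<close> lowers the index of \<open>censored_coeff\<close> by one. The index shift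
  produces the factor \<open>z\<close>, and the term \<open>N = 0\<close> has no
  predecessor.\<close>

lemma sums_deriv_coeff:
  assumes \<beta>: "0 < \<beta>" "\<beta> < 1"
  shows "(\<lambda>N. deriv_coeff \<beta> N * z ^ N) sums (z * censored_exp \<beta> z + censored_exp \<beta> z / Gamma (1 - \<beta>))"
proof -
  have eq: "deriv_coeff \<beta> N * z ^ N = (case N of 0 \<Rightarrow> 0 | Suc n \<Rightarrow> z * (censored_coeff \<beta> n * z ^ n))
      + censored_coeff \<beta> N * z ^ N / Gamma (1 - \<beta>)" for N
  proof (cases N)
    case (Suc n)
    define d where "d = censored_factor \<beta> (real N * \<beta>)"
    have "0 < real N * \<beta>" using \<beta> Suc by simp
    then have "d > 0" unfolding d_def by (rule censored_factor_pos[OF \<beta>])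
    have "Gamma (1 + real N * \<beta>) / Gamma (real N * \<beta> + 1 - \<beta>) = d + 1 / Gamma (1 - \<beta>)"
      by (simp add: d_def censored_factor_def)
    moreover have "censored_coeff \<beta> n = censored_coeff \<beta> N * d"
      using \<open>d > 0\<close> by (simp add: Suc censored_coeff_Suc d_def)
    ultimately show ?thesis by (simp add: deriv_coeff_def Suc algebra_simps)
  qed (simp add: deriv_coeff_def)
  have "(\<lambda>n. z * (censored_coeff \<beta> n * z ^ n)) sums (z * censored_exp \<beta> z)"
    by (intro sums_mult sums_censored_exp \<beta>)
  then have "(\<lambda>N. case N of 0 \<Rightarrow> 0 | Suc n \<Rightarrow> z * (censored_coeff \<beta> n * z ^ n)) sums (z * censored_exp \<beta> z)"
    using sums_Suc_imp[of "\<lambda>N. case N of 0 \<Rightarrow> 0 | Suc n \<Rightarrow> z * (censored_coeff \<beta> n * z ^ n)"] by simp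
  then show ?thesis
    unfolding eq by (intro sums_add sums_divide sums_censored_exp \<beta>)
qed

text \<open>The denominators are at least \<open>1 - \<beta>\<close>, so the series is dominated by
  that of \<open>deriv_coeff\<close> at \<open>|z|\<close>.\<close>

lemma summable_RL_coeff:
  assumes \<beta>: "0 < \<beta>" "\<beta> < 1"
  shows "summable (\<lambda>N. RL_coeff \<beta> N * z ^ N)"
proof (rule summable_comparison_test')
  show "summable (\<lambda>N. deriv_coeff \<beta> N * \<bar>z\<bar> ^ N / (1 - \<beta>))"
    using sums_deriv_coeff[OF \<beta>] by (intro summable_divide) (rule sums_summable)
  fix N :: nat
  have le: "1 - \<beta> \<le> real N * \<beta> + 1 - \<beta>" using \<beta> by simp
  then have pos: "0 < real N * \<beta> + 1 - \<beta>" using \<beta> by linarith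
  have "deriv_coeff \<beta> N / (real N * \<beta> + 1 - \<beta>) \<le> deriv_coeff \<beta> N / (1 - \<beta>)"
    using deriv_coeff_nonneg[OF \<beta>, of N] \<beta> le pos by (intro divide_left_mono mult_pos_pos) auto
  moreover have "\<bar>RL_coeff \<beta> N\<bar> = deriv_coeff \<beta> N / (real N * \<beta> + 1 - \<beta>)"
    using deriv_coeff_nonneg[OF \<beta>, of N] pos by (simp add: RL_coeff_def)
  ultimately have "\<bar>RL_coeff \<beta> N\<bar> * \<bar>z\<bar> ^ N \<le> deriv_coeff \<beta> N / (1 - \<beta>) * \<bar>z\<bar> ^ N"
    by (intro mult_right_mono) auto
  then show "norm (RL_coeff \<beta> N * z ^ N) \<le> deriv_coeff \<beta> N * \<bar>z\<bar> ^ N / (1 - \<beta>)"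
    by (simp add: abs_mult power_abs)
qed

lemma RL_int_censored_exp:
  assumes \<beta>: "0 < \<beta>" "\<beta> < 1" and "0 < x"
  shows "RL_int (1 - \<beta>) (\<lambda>x. censored_exp \<beta> (lam * x powr \<beta>)) x
           = x powr (1 - \<beta>) * (\<Sum>N. RL_coeff \<beta> N * (lam * x powr \<beta>) ^ N)"
proof -
  \<comment> \<open>The parameter \<open>l\<close> stands for \<open>lam\<close> or
    \<open>|lam|\<close>: the norm of a term for \<open>lam\<close> is the term for
    \<open>|lam|\<close>. One integral formula thus gives both the integrated series and the
    absolute summability needed to exchange sum and integral.\<close>
  define f where "f l N r = indicator {0<..<x} r *
     ((x - r) powr (1 - \<beta> - 1) / Gamma (1 - \<beta>) * (censored_coeff \<beta> N * (l * r powr \<beta>) ^ N))"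
    for l N r
  have G: "0 < Gamma (1 - \<beta>)" using \<beta> by (intro Gamma_real_pos) simp
  have f: "has_bochner_integral lborel (f l N)
      (x powr (1 - \<beta>) * (RL_coeff \<beta> N * (l * x powr \<beta>) ^ N))" for l N
  proof -
    define q where "q = real N * \<beta>"
    define c where "c = censored_coeff \<beta> N * l ^ N / Gamma (1 - \<beta>)"
    have "0 \<le> q" using \<beta> by (simp add: q_def)
    have pow: "(l * r powr \<beta>) ^ N = l ^ N * r powr q" if "0 < r" for r
      using that by (simp add: power_mult_distrib powr_power q_def mult.commute)
    have "has_bochner_integral lborel
       (\<lambda>r. c * (indicator {0<..<x} r * ((x - r) powr (1 - \<beta> - 1) * (r - 0) powr (q + 1 - 1))))
       (c * (Beta (1 - \<beta>) (q + 1) * (x - 0) powr ((1 - \<beta>) + (q + 1) - 1)))"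
      by (intro has_bochner_integral_mult_right has_bochner_integral_Beta_interval)
        (use \<beta> \<open>0 \<le> q\<close> \<open>0 < x\<close> in auto)
    also have "(\<lambda>r. c * (indicator {0<..<x} r * ((x - r) powr (1 - \<beta> - 1) * (r - 0) powr (q + 1 - 1)))) = f l N"
      by (auto simp: f_def fun_eq_iff indicator_def c_def pow)
    also have "c * (Beta (1 - \<beta>) (q + 1) * (x - 0) powr ((1 - \<beta>) + (q + 1) - 1))
       = x powr (1 - \<beta>) * (RL_coeff \<beta> N * (l * x powr \<beta>) ^ N)"
    proof -
      \<comment> \<open>The functional equation splits the factor \<open>q + 1 - \<beta>\<close> off
        the Gamma value in the Beta function; it is the denominator in
        \<open>RL_coeff\<close>.\<close>
      have "q + 1 - \<beta> \<notin> \<int>\<^sub>\<le>\<^sub>0" using \<beta> \<open>0 \<le> q\<close> by (auto elim!: nonpos_Ints_cases)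
      from Gamma_plus1[OF this]
      have "Gamma (1 - \<beta> + (q + 1)) = (q + 1 - \<beta>) * Gamma (q + 1 - \<beta>)"
        by (simp add: algebra_simps)
      moreover have "x powr ((1 - \<beta>) + (q + 1) - 1) = x powr (1 - \<beta>) * x powr q"
        by (simp flip: powr_add add: algebra_simps)
      ultimately show ?thesis
        using G \<open>0 < x\<close> by (simp add: RL_coeff_def deriv_coeff_def c_def Beta_def pow
            add.commute[of 1 q] flip: q_def) (simp add: mult_ac)
    qed
    finally show ?thesis .
  qed
  have norm_f: "norm (f lam N r) = f \<bar>lam\<bar> N r" for N r
    using G censored_coeff_pos[OF \<beta>, of N] by (simp add: f_def abs_mult power_abs)
  have f_sums: "(\<lambda>N. f l N r) sums (indicator {0<..<x} r *
     ((x - r) powr (1 - \<beta> - 1) / Gamma (1 - \<beta>) * censored_exp \<beta> (l * r powr \<beta>)))" for l r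
    unfolding f_def by (intro sums_mult sums_censored_exp \<beta>)
  have "(\<lambda>N. integral\<^sup>L lborel (f lam N)) sums (LBINT r. \<Sum>N. f lam N r)"
  proof (rule sums_integral)
    show "integrable lborel (f lam N)" for N using f[of lam N] by (simp add: has_bochner_integral_iff)
    show "summable (\<lambda>N. LBINT r. norm (f lam N r))"
      unfolding norm_f using f[of "\<bar>lam\<bar>"] summable_RL_coeff[OF \<beta>]
      by (simp add: has_bochner_integral_iff summable_mult)
    show "AE r in lborel. summable (\<lambda>N. norm (f lam N r))"
      unfolding norm_f by (intro AE_I2 sums_summable[OF f_sums])
  qed
  also have "(LBINT r. \<Sum>N. f lam N r) = RL_int (1 - \<beta>) (\<lambda>x. censored_exp \<beta> (lam * x powr \<beta>)) x"
    unfolding RL_int_def set_lebesgue_integral_def sums_unique[OF f_sums, symmetric] by simp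
  finally have "RL_int (1 - \<beta>) (\<lambda>x. censored_exp \<beta> (lam * x powr \<beta>)) x
     = (\<Sum>N. x powr (1 - \<beta>) * (RL_coeff \<beta> N * (lam * x powr \<beta>) ^ N))"
    using f[of lam] by (simp add: has_bochner_integral_iff sums_iff)
  then show ?thesis using suminf_mult[OF summable_RL_coeff[OF \<beta>]] by simp
qed

text \<open>With \<open>G\<close> the power series of \<open>RL_coeff\<close> and
  \<open>z = lam * x powr \<beta>\<close>, the product and chain rules give
  \<open>x powr -\<beta>\<close> times \<open>(1 - \<beta>) * G z + \<beta> * (z * G' z)\<close>.
  This Euler operator multiplies the n-th coefficient by \<open>n * \<beta> + 1 - \<beta>\<close>,
  which turns \<open>RL_coeff\<close> into \<open>deriv_coeff\<close>.\<close>

lemma has_real_derivative_RL_int_censored_exp: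
  assumes \<beta>: "0 < \<beta>" "\<beta> < 1" and "0 < x"
  shows "(RL_int (1 - \<beta>) (\<lambda>x. censored_exp \<beta> (lam * x powr \<beta>)) has_real_derivative
           (x powr - \<beta> / Gamma (1 - \<beta>) + lam) * censored_exp \<beta> (lam * x powr \<beta>)) (at x)"
proof -
  define G where "G = (\<lambda>z. \<Sum>N. RL_coeff \<beta> N * z ^ N)"
  define G' where "G' = (\<lambda>z. \<Sum>N. diffs (RL_coeff \<beta>) N * z ^ N)"
  define z where "z = lam * x powr \<beta>"
  have G: "(G has_real_derivative G' z) (at z)" for z
    unfolding G_def G'_def by (intro termdiffs_strong_converges_everywhere summable_RL_coeff \<beta>)
  have Euler: "(1 - \<beta>) * G z + \<beta> * (z * G' z) = z * censored_exp \<beta> z + censored_exp \<beta> z / Gamma (1 - \<beta>)"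
  proof (rule sums_unique2[OF _ sums_deriv_coeff[OF \<beta>]])
    have "(\<lambda>n. of_nat n * RL_coeff \<beta> n * z ^ (n - Suc 0)) sums G' z"
      unfolding G'_def by (intro diffs_equiv termdiff_converges_all summable_RL_coeff \<beta>)
    then have "(\<lambda>n. (1 - \<beta>) * (RL_coeff \<beta> n * z ^ n) + \<beta> * (z * (of_nat n * RL_coeff \<beta> n * z ^ (n - Suc 0))))
      sums ((1 - \<beta>) * G z + \<beta> * (z * G' z))"
      unfolding G_def by (intro sums_add sums_mult summable_sums summable_RL_coeff \<beta>)
    also have "(\<lambda>n. (1 - \<beta>) * (RL_coeff \<beta> n * z ^ n) + \<beta> * (z * (of_nat n * RL_coeff \<beta> n * z ^ (n - Suc 0))))
       = (\<lambda>n. deriv_coeff \<beta> n * z ^ n)"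
    proof
      fix n
      have "real n * \<beta> + 1 - \<beta> > 0" using \<beta> by (simp add: add_diff_eq[symmetric] add_nonneg_pos)
      then have e1: "deriv_coeff \<beta> n = (1 - \<beta> + \<beta> * real n) * RL_coeff \<beta> n"
        by (simp add: RL_coeff_def field_simps)
      have e2: "z * (real n * RL_coeff \<beta> n * z ^ (n - Suc 0)) = real n * RL_coeff \<beta> n * z ^ n"
        by (cases n) auto
      show "(1 - \<beta>) * (RL_coeff \<beta> n * z ^ n) + \<beta> * (z * (real n * RL_coeff \<beta> n * z ^ (n - Suc 0)))
         = deriv_coeff \<beta> n * z ^ n"
        unfolding e1 e2 by (simp add: algebra_simps)
    qed
    finally show "(\<lambda>n. deriv_coeff \<beta> n * z ^ n) sums ((1 - \<beta>) * G z + \<beta> * (z * G' z))" .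
  qed
  have "((\<lambda>x. x powr (1 - \<beta>) * G (lam * x powr \<beta>)) has_real_derivative
      (1 - \<beta>) * x powr (1 - \<beta> - 1) * G z + x powr (1 - \<beta>) * (G' z * (lam * (\<beta> * x powr (\<beta> - 1))))) (at x)"
    unfolding z_def using \<open>0 < x\<close>
    by (auto intro!: derivative_eq_intros DERIV_chain2[OF G])
  also have "x powr (1 - \<beta>) * (G' z * (lam * (\<beta> * x powr (\<beta> - 1)))) = x powr - \<beta> * (\<beta> * (z * G' z))"
  proof -
    have "x powr (1 - \<beta>) * x powr (\<beta> - 1) = 1" "x powr - \<beta> * x powr \<beta> = 1"
      using \<open>0 < x\<close> by (simp_all flip: powr_add)
    then show ?thesis by (simp add: z_def algebra_simps)
  qed
  also have "(1 - \<beta>) * x powr (1 - \<beta> - 1) * G z + x powr - \<beta> * (\<beta> * (z * G' z))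
     = x powr - \<beta> * (z * censored_exp \<beta> z + censored_exp \<beta> z / Gamma (1 - \<beta>))"
    unfolding Euler[symmetric] by (simp add: algebra_simps)
  also have "\<dots> = (x powr - \<beta> / Gamma (1 - \<beta>) + lam) * censored_exp \<beta> z"
  proof -
    have "x powr - \<beta> * z = lam" using \<open>0 < x\<close> by (simp add: z_def powr_minus)
    then have "x powr - \<beta> * (z * censored_exp \<beta> z) = lam * censored_exp \<beta> z"
      by (simp only: mult.assoc[symmetric])
    then show ?thesis by (simp add: algebra_simps)
  qed
  \<comment> \<open>The series formula for the integral is available only for positive arguments, so
    the derivative is transferred on the open half-line.\<close>
  finally show ?thesis
    unfolding z_def
    by (rule has_field_derivative_transform_within_open[of _ _ _ "{0<..}"])
      (use \<open>0 < x\<close> in \<open>auto simp: RL_int_censored_exp[OF \<beta>] G_def\<close>)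
qed

text \<open>The derivative of the Riemann-Liouville integral contains
  \<open>x powr -\<beta> / Gamma (1 - \<beta>)\<close> times the solution. The censored derivative
  subtracts exactly this term and leaves \<open>lam\<close> times the solution.\<close>

lemma solves_linear_ivp_censored_exp:
  assumes \<beta>: "0 < \<beta>" "\<beta> < 1" and "0 < T"
  shows "solves_linear_ivp \<beta> T lam u0 (\<lambda>x. u0 * censored_exp \<beta> (lam * x powr \<beta>))"
proof -
  let ?u = "\<lambda>x. u0 * censored_exp \<beta> (lam * x powr \<beta>)"
  have cont: "continuous_on {0..T} ?u"
    by (intro continuous_intros continuous_on_censored_exp_powr \<beta>)
  then have cont': "continuous_on {0<..T} ?u" by (rule continuous_on_subset) auto
  from cont have "set_integrable lborel {0..T} ?u" by (rule borel_integrable_atLeastAtMost')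
  then have "set_integrable lborel {0<..T} ?u" by (rule set_integrable_subset) auto
  then have CL1: "?u \<in> CL1 T"
    using cont' by (simp add: CL1_def)
  have RL: "RL_int (1 - \<beta>) ?u = (\<lambda>x. u0 * RL_int (1 - \<beta>) (\<lambda>x. censored_exp \<beta> (lam * x powr \<beta>)) x)"
    by (simp add: RL_int_def set_lebesgue_integral_def fun_eq_iff mult.left_commute[of _ u0])
  let ?d = "\<lambda>x. (x powr - \<beta> / Gamma (1 - \<beta>) + lam) * ?u x"
  have der: "(RL_int (1 - \<beta>) ?u has_real_derivative ?d x) (at x within S)" if "0 < x" for x S
    unfolding RL
    by (rule has_field_derivative_at_within,
        rule DERIV_cong[OF DERIV_cmult[OF has_real_derivative_RL_int_censored_exp[OF \<beta> that]]])
      (simp only: mult_ac)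
  have "continuous_on {0<..T} ?d"
    unfolding divide_inverse
    by (intro continuous_on_add continuous_on_mult[OF _ cont'] continuous_on_mult continuous_on_const
        continuous_on_powr continuous_on_id) auto
  then have C1: "RL_int (1 - \<beta>) ?u \<in> C1_on {0<..T}"
    unfolding C1_on_def using der by force
  have "censored_deriv \<beta> T ?u x = lam * ?u x" if "x \<in> {0<..T}" for x
  proof -
    have "vector_derivative (RL_int (1 - \<beta>) ?u) (at x within {0<..T}) = ?d x"
      using that der[of x "{0<..T}"]
      by (intro vector_derivative_within)
        (auto simp: trivial_limit_within has_real_derivative_iff_has_vector_derivative)
    then show ?thesis by (simp add: censored_deriv_def algebra_simps)
  qed
  then show ?thesis
    using cont CL1 C1 \<beta> by (simp add: solves_linear_ivp_def C_beta_closed_def C_beta_def censored_exp_0)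
qed

subsection \<open>Uniqueness\<close>

lemma solves_linear_ivp_has_derivative:
  assumes "solves_linear_ivp \<beta> T lam u0 v" "x \<in> {0<..T}"
  shows "(RL_int (1 - \<beta>) v has_real_derivative (x powr - \<beta> / Gamma (1 - \<beta>) + lam) * v x)
           (at x within {0<..T})"
proof -
  have "RL_int (1 - \<beta>) v \<in> C1_on {0<..T}"
    using assms(1) by (simp add: solves_linear_ivp_def C_beta_closed_def C_beta_def)
  then obtain f' where f': "(RL_int (1 - \<beta>) v has_real_derivative f' x) (at x within {0<..T})"
    unfolding C1_on_def using assms(2) by blast
  \<comment> \<open>Every point of \<open>{0<..T}\<close>, including \<open>T\<close>, is a limit
    point of the interval, so the derivative relative to it is unique.\<close>
  moreover have "vector_derivative (RL_int (1 - \<beta>) v) (at x within {0<..T}) = f' x"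
    using assms(2) f'
    by (intro vector_derivative_within)
      (auto simp: trivial_limit_within has_real_derivative_iff_has_vector_derivative)
  ultimately show ?thesis
    using assms by (simp add: solves_linear_ivp_def censored_deriv_def algebra_simps)
qed

lemma RL_int_1: "RL_int 1 f x = (LBINT r:{0<..<x}. f r)"
  unfolding RL_int_def set_lebesgue_integral_def
  by (rule Bochner_Integration.integral_cong) (auto simp: indicator_def)

lemma RL_int_cong:
  assumes "\<And>r. 0 < r \<Longrightarrow> r < x \<Longrightarrow> f r = g r"
  shows "RL_int \<gamma> f x = RL_int \<gamma> g x"
  unfolding RL_int_def set_lebesgue_integral_def
  by (rule Bochner_Integration.integral_cong) (auto simp: indicator_def assms)

lemma RL_int_eq_beta_average:
  assumes "0 < x"
  shows "RL_int \<gamma> w x = x powr \<gamma> * beta_average \<gamma> 1 w x / Gamma \<gamma>"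
proof -
  \<comment> \<open>The factor \<open>r powr (1 - 1)\<close> equals 1 on the open interval and
    produces the Beta weight with \<open>b = 1\<close>.\<close>
  have "RL_int \<gamma> w x = (LBINT r. (indicator {0<..<x} r * ((x - r) powr (\<gamma> - 1) * r powr (1 - 1) * w r)) / Gamma \<gamma>)"
    unfolding RL_int_def set_lebesgue_integral_def
    by (rule Bochner_Integration.integral_cong) (auto simp: indicator_def)
  also have "\<dots> = (LBINT r:{0<..<x}. (x - r) powr (\<gamma> - 1) * r powr (1 - 1) * w r) / Gamma \<gamma>"
    unfolding set_lebesgue_integral_def by (subst integral_divide_zero) simp
  finally show ?thesis unfolding set_integral_beta_weight[OF assms] by simp
qed

text \<open>The kernel of $\mathcal K + \lambda J_0^\beta$.\<close>

definition censored_kernel :: "real \<Rightarrow> real \<Rightarrow> real \<Rightarrow> real \<Rightarrow> real" where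
  "censored_kernel \<beta> lam x r = (x - r) powr (\<beta> - 1) / Gamma \<beta> * (r powr - \<beta> / Gamma (1 - \<beta>) + lam)"

text \<open>The kernel combines the Beta weights with \<open>b = 1 - \<beta>\<close> and
  \<open>b = 1\<close>. For the first, the powers of \<open>x\<close> from the scaling cancel, so
  the right-hand side also makes sense as a continuous function at 0.\<close>

lemma censored_kernel_integral:
  assumes \<beta>: "0 < \<beta>" "\<beta> < 1" and w: "continuous_on {0..T} w" and x: "0 < x" "x \<le> T"
  shows "set_integrable lborel {0<..<x} (\<lambda>r. censored_kernel \<beta> lam x r * w r)"
    and "(LBINT r:{0<..<x}. censored_kernel \<beta> lam x r * w r)
           = beta_average \<beta> (1 - \<beta>) w x / (Gamma \<beta> * Gamma (1 - \<beta>))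
             + lam * x powr \<beta> * beta_average \<beta> 1 w x / Gamma \<beta>"
proof -
  define f where "f b r = indicator {0<..<x} r * ((x - r) powr (\<beta> - 1) * r powr (b - 1) * w r)" for b r
  define c where "c = 1 / (Gamma \<beta> * Gamma (1 - \<beta>))"
  have f: "integrable lborel (f b)" if "0 < b" for b
    using set_integrable_beta_weight[OF \<beta>(1) that x w] by (simp add: set_integrable_def f_def[abs_def])
  have f': "integral\<^sup>L lborel (f b) = x powr (\<beta> + b - 1) * beta_average \<beta> b w x" for b
    using set_integral_beta_weight[OF x(1), of \<beta> b w] by (simp add: set_lebesgue_integral_def f_def[abs_def])
  have eq: "(\<lambda>r. indicator {0<..<x} r *\<^sub>R (censored_kernel \<beta> lam x r * w r))
      = (\<lambda>r. c * f (1 - \<beta>) r + lam / Gamma \<beta> * f 1 r)"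
    by (auto simp: fun_eq_iff censored_kernel_def f_def c_def indicator_def algebra_simps)
  show "set_integrable lborel {0<..<x} (\<lambda>r. censored_kernel \<beta> lam x r * w r)"
    unfolding set_integrable_def eq using \<beta>
    by (intro Bochner_Integration.integrable_add integrable_mult_right f) auto
  show "(LBINT r:{0<..<x}. censored_kernel \<beta> lam x r * w r)
           = beta_average \<beta> (1 - \<beta>) w x / (Gamma \<beta> * Gamma (1 - \<beta>))
             + lam * x powr \<beta> * beta_average \<beta> 1 w x / Gamma \<beta>"
    unfolding set_lebesgue_integral_def eq using \<beta> x
    by (subst Bochner_Integration.integral_add) (auto simp: f f' c_def)
qed

text \<open>The indefinite integral of \<open>f - g\<close> vanishes identically, and its one-sided
  or two-sided derivative at \<open>x\<close> is \<open>f x - g x\<close>.\<close>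

lemma continuous_on_eq_if_integral_eq:
  fixes f g :: "real \<Rightarrow> real"
  assumes f: "continuous_on {0..T} f" and g: "continuous_on {0..T} g" and "0 < T"
    and eq: "\<And>x. 0 < x \<Longrightarrow> x \<le> T \<Longrightarrow> (LBINT r:{0<..<x}. f r) = (LBINT r:{0<..<x}. g r)"
    and x: "x \<in> {0..T}"
  shows "f x = g x"
proof -
  have int: "(LBINT r:{0<..<y}. h r) = integral {0..y} h"
    if "continuous_on {0..T} h" "0 < y" "y \<le> T" for h :: "real \<Rightarrow> real" and y
  proof -
    have "set_integrable lborel {0..y} h"
      by (rule borel_integrable_atLeastAtMost', rule continuous_on_subset[OF that(1)]) (use that in auto)
    then have "set_integrable lborel {0<..<y} h" by (rule set_integrable_subset) auto
    then show ?thesis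
      by (simp add: set_borel_integral_eq_integral(2) integral_open_interval_real)
  qed
  have "((\<lambda>x. integral {0..x} (\<lambda>r. f r - g r)) has_real_derivative f x - g x) (at x within {0..T})"
    by (rule integral_has_real_derivative[OF _ x]) (intro continuous_intros f g)
  moreover have "integral {0..y} (\<lambda>r. f r - g r) = 0" if "y \<in> {0..T}" for y
  proof (cases "y = 0")
    case False
    have "f integrable_on {0..y}" "g integrable_on {0..y}"
      using that by (auto intro!: integrable_continuous_real continuous_on_subset[OF f] continuous_on_subset[OF g])
    then show ?thesis
      using eq[of y] int[OF f, of y] int[OF g, of y] that False
      by (simp add: Henstock_Kurzweil_Integration.integral_diff)
  qed simp
  ultimately have "((\<lambda>_. 0) has_real_derivative f x - g x) (at x within {0..T})"
    using x by (elim has_field_derivative_transform_within[OF _ zero_less_one]) auto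
  moreover have "((\<lambda>_. 0) has_real_derivative 0) (at x within {0..T})" by simp
  moreover have "at x within {0..T} \<noteq> bot"
    using x \<open>0 < T\<close> by (simp add: trivial_limit_within)
  ultimately have "f x - g x = 0"
    by (meson vector_derivative_unique_within has_real_derivative_iff_has_vector_derivative)
  then show ?thesis by simp
qed

text \<open>Write J for \<open>RL_int\<close>, with its order as index. Integrating the equation
  gives \<open>J_(1-\<beta>) v = J_1 h\<close>. Applying \<open>J_\<beta>\<close> and the semigroup
  law gives \<open>J_1 v = J_1 (J_\<beta> h)\<close>, and \<open>J_1\<close> is cancelled by
  continuity of both arguments.\<close>

lemma solves_linear_ivp_integral_equation:
  assumes \<beta>: "0 < \<beta>" "\<beta> < 1" and "0 < T" and v: "solves_linear_ivp \<beta> T lam u0 v"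
    and x: "x \<in> {0<..T}"
  shows "v x = (LBINT r:{0<..<x}. censored_kernel \<beta> lam x r * v r)"
proof -
  define h where "h r = (r powr - \<beta> / Gamma (1 - \<beta>) + lam) * v r" for r
  \<comment> \<open>A representative of \<open>RL_int \<beta> h\<close> that is visibly continuous
    on all of \<open>{0..T}\<close>.\<close>
  define W where "W y = beta_average \<beta> (1 - \<beta>) v y / (Gamma \<beta> * Gamma (1 - \<beta>))
             + lam * y powr \<beta> * beta_average \<beta> 1 v y / Gamma \<beta>" for y
  have cont: "continuous_on {0..T} v"
    using v by (simp add: solves_linear_ivp_def C_beta_closed_def)
  have W: "RL_int \<beta> h y = W y" if "0 < y" "y \<le> T" for y
    using censored_kernel_integral(2)[OF \<beta> cont that, of lam]
    by (simp add: RL_int_def h_def W_def censored_kernel_def mult_ac)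
  have h_int: "set_integrable lborel {0<..<y} h" if "0 < y" "y \<le> T" for y
  proof -
    \<comment> \<open>Two Beta weights with \<open>a = 1\<close>, for which the factor in
      \<open>y - r\<close> is 1.\<close>
    have "integrable lborel (\<lambda>r. (1 / Gamma (1 - \<beta>)) * (indicator {0<..<y} r * ((y - r) powr (1 - 1) * r powr (1 - \<beta> - 1) * v r))
       + lam * (indicator {0<..<y} r * ((y - r) powr (1 - 1) * r powr (1 - 1) * v r)))"
      using set_integrable_beta_weight[of 1 "1 - \<beta>", OF _ _ that cont]
        set_integrable_beta_weight[of 1 1, OF _ _ that cont] \<beta>
      by (intro Bochner_Integration.integrable_add integrable_mult_right) (auto simp: set_integrable_def)
    also have "(\<lambda>r. (1 / Gamma (1 - \<beta>)) * (indicator {0<..<y} r * ((y - r) powr (1 - 1) * r powr (1 - \<beta> - 1) * v r))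
       + lam * (indicator {0<..<y} r * ((y - r) powr (1 - 1) * r powr (1 - 1) * v r)))
       = (\<lambda>r. indicator {0<..<y} r *\<^sub>R h r)"
      by (auto simp: fun_eq_iff h_def indicator_def algebra_simps)
    finally show ?thesis by (simp add: set_integrable_def)
  qed
  have v_int: "set_integrable lborel {0<..<y} v" if "0 < y" "y \<le> T" for y
  proof -
    have "set_integrable lborel {0..T} v" by (rule borel_integrable_atLeastAtMost'[OF cont])
    then show ?thesis by (rule set_integrable_subset) (use that in auto)
  qed
  have FTC: "RL_int (1 - \<beta>) v y = RL_int 1 h y" if y: "0 < y" "y \<le> T" for y
  proof -
    define F where "F x = x powr (1 - \<beta>) * beta_average (1 - \<beta>) 1 v x / Gamma (1 - \<beta>)" for x
    have F: "RL_int (1 - \<beta>) v x = F x" if "0 \<le> x" for x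
    proof (cases "x = 0")
      case False
      then show ?thesis unfolding F_def using that by (intro RL_int_eq_beta_average) simp
    qed (simp add: RL_int_def set_lebesgue_integral_def F_def)
    have "continuous_on {0..T} F"
      unfolding F_def divide_inverse
      by (intro continuous_on_add continuous_on_mult continuous_on_const continuous_on_id
          continuous_on_powr' continuous_on_beta_average cont) (use \<beta> in auto)
    then have contF: "continuous_on {0..y} (RL_int (1 - \<beta>) v)"
      using y by (subst continuous_on_cong[OF refl F]) (auto elim: continuous_on_subset)
    \<comment> \<open>Since \<open>h\<close> may blow up like \<open>t powr -\<beta>\<close> at 0,
      the interior form of the fundamental theorem is used: derivatives inside, continuity up to the
      endpoints.\<close>
    have "(h has_integral (RL_int (1 - \<beta>) v y - RL_int (1 - \<beta>) v 0)) {0..y}"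
    proof (rule fundamental_theorem_of_calculus_interior[OF _ contF])
      fix t assume t: "t \<in> {0<..<y}"
      then have "(RL_int (1 - \<beta>) v has_real_derivative h t) (at t within {0<..T})"
        unfolding h_def using y by (intro solves_linear_ivp_has_derivative[OF v]) auto
      then have "(RL_int (1 - \<beta>) v has_real_derivative h t) (at t within {0<..<y})"
        by (rule DERIV_subset) (use y in auto)
      then show "(RL_int (1 - \<beta>) v has_vector_derivative h t) (at t)"
        unfolding at_within_open[OF t open_greaterThanLessThan]
          has_real_derivative_iff_has_vector_derivative .
    qed (use y in simp)
    moreover have "RL_int (1 - \<beta>) v 0 = 0" by (simp add: RL_int_def set_lebesgue_integral_def)
    ultimately have "(h has_integral RL_int (1 - \<beta>) v y) {0<..<y}"
      by (simp add: has_integral_Icc_iff_Ioo)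
    then show ?thesis
      using set_borel_integral_eq_integral(2)[OF h_int[OF y]] by (simp add: RL_int_1 integral_unique)
  qed
  \<comment> \<open>Every composition in this chain has total order 1 or \<open>1 + \<beta>\<close>,
    as the semigroup law demands order at least 1.\<close>
  have "(LBINT r:{0<..<y}. v r) = (LBINT r:{0<..<y}. W r)" if y: "0 < y" "y \<le> T" for y
  proof -
    have "(LBINT r:{0<..<y}. v r) = RL_int (\<beta> + (1 - \<beta>)) v y" by (simp add: RL_int_1)
    also have "\<dots> = RL_int \<beta> (RL_int (1 - \<beta>) v) y"
      by (rule RL_int_RL_int[symmetric]) (use \<beta> y v_int in auto)
    also have "\<dots> = RL_int \<beta> (RL_int 1 h) y"
      by (rule RL_int_cong) (use FTC y in auto)
    also have "\<dots> = RL_int (1 + \<beta>) h y"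
      using RL_int_RL_int[OF _ _ _ y(1) h_int[OF y], of \<beta> 1] \<beta> by (simp add: add.commute)
    also have "\<dots> = RL_int 1 (RL_int \<beta> h) y"
      by (rule RL_int_RL_int[symmetric]) (use \<beta> y h_int in auto)
    also have "\<dots> = RL_int 1 W y"
      by (rule RL_int_cong) (use W y in auto)
    finally show ?thesis by (simp add: RL_int_1)
  qed
  moreover have "continuous_on {0..T} W"
    unfolding W_def divide_inverse
    by (intro continuous_on_add continuous_on_mult continuous_on_const continuous_on_id
        continuous_on_powr' continuous_on_beta_average cont) (use \<beta> in auto)
  ultimately have "v x = W x"
    using cont \<open>0 < T\<close> x by (intro continuous_on_eq_if_integral_eq[of T v W]) auto
  then show ?thesis
    using censored_kernel_integral(2)[OF \<beta> cont, of x lam] x by (simp add: W_def)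
qed

text \<open>The kernel is strictly positive, and by continuity \<open>y\<close> is positive on some
  \<open>{0<..<e}\<close>. A zero integral of the nonnegative integrand would make this interval a
  null set.\<close>

lemma censored_kernel_integral_pos:
  assumes \<beta>: "0 < \<beta>" "\<beta> < 1" and y: "continuous_on {0..T} y" and x: "0 < x" "x \<le> T"
    and "0 \<le> lam" and nonneg: "\<And>r. 0 \<le> r \<Longrightarrow> r \<le> x \<Longrightarrow> 0 \<le> y r" and "0 < y 0"
  shows "0 < (LBINT r:{0<..<x}. censored_kernel \<beta> lam x r * y r)"
proof -
  let ?f = "\<lambda>r. indicator {0<..<x} r *\<^sub>R (censored_kernel \<beta> lam x r * y r)"
  have pos: "0 < Gamma \<beta>" "0 < Gamma (1 - \<beta>)" using \<beta> by (auto intro!: Gamma_real_pos)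
  have k: "0 < censored_kernel \<beta> lam x r" if "0 < r" "r < x" for r
    unfolding censored_kernel_def using pos that \<open>0 \<le> lam\<close>
    by (intro mult_pos_pos divide_pos_pos add_pos_nonneg) auto
  have f: "integrable lborel ?f"
    using censored_kernel_integral(1)[OF \<beta> y x] by (simp add: set_integrable_def)
  have f_nonneg: "0 \<le> ?f r" for r
    using k[of r] nonneg[of r] by (auto simp: indicator_def intro: mult_nonneg_nonneg less_imp_le)
  have "integral\<^sup>L lborel ?f \<noteq> 0"
  proof
    assume "integral\<^sup>L lborel ?f = 0"
    then have AE0: "AE r in lborel. ?f r = 0"
      using f_nonneg by (subst (asm) integral_nonneg_eq_0_iff_AE[OF f]) auto
    have "0 \<in> {0..T}" using x by simp
    with y \<open>0 < y 0\<close> obtain d where d: "d > 0" "\<And>r. r \<in> {0..T} \<Longrightarrow> dist r 0 < d \<Longrightarrow> dist (y r) (y 0) < y 0"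
      unfolding continuous_on_iff by blast
    define e where "e = min d x"
    have e: "0 < e" "e \<le> d" "e \<le> x" using d x by (auto simp: e_def)
    have "?f r \<noteq> 0" if "r \<in> {0<..<e}" for r
    proof -
      have "dist (y r) (y 0) < y 0" using d(2)[of r] that e x by auto
      then have "0 < y r" by (auto simp: dist_real_def)
      then show ?thesis using k[of r] that e by auto
    qed
    with AE0 have "AE r in lborel. r \<notin> {0<..<e}" by (auto elim: eventually_mono)
    then have "emeasure lborel {0<..<e} = 0"
      by (subst (asm) AE_iff_null_sets[symmetric]) (auto simp: null_sets_def)
    with e show False by simp
  qed
  moreover have "0 \<le> integral\<^sup>L lborel ?f" using f_nonneg by (intro Bochner_Integration.integral_nonneg) auto
  ultimately show ?thesis by (simp add: set_lebesgue_integral_def)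
qed

lemma solves_linear_ivp_unique:
  assumes \<beta>: "0 < \<beta>" "\<beta> < 1" and T: "0 < T"
    and v1: "solves_linear_ivp \<beta> T lam u0 v1" and v2: "solves_linear_ivp \<beta> T lam u0 v2"
    and x: "x \<in> {0..T}"
  shows "v1 x = v2 x"
proof (rule ccontr)
  assume neq: "v1 x \<noteq> v2 x"
  define w where "w x = v1 x - v2 x" for x
  \<comment> \<open>The comparison function solves the problem with \<open>|lam|\<close> and initial
    value 1; the factor 1 matches the form of the existence lemma.\<close>
  define U where "U x = 1 * censored_exp \<beta> (\<bar>lam\<bar> * x powr \<beta>)" for x
  have v_cont: "continuous_on {0..T} v1" "continuous_on {0..T} v2"
    using v1 v2 by (auto simp: solves_linear_ivp_def C_beta_closed_def)
  then have w_cont: "continuous_on {0..T} w" unfolding w_def by (intro continuous_intros)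
  have U_sol: "solves_linear_ivp \<beta> T \<bar>lam\<bar> 1 U"
    unfolding U_def by (rule solves_linear_ivp_censored_exp[OF \<beta> T])
  then have U_cont: "continuous_on {0..T} U" by (auto simp: solves_linear_ivp_def C_beta_closed_def)
  have U1: "1 \<le> U x" for x
    unfolding U_def using censored_exp_ge_1[OF \<beta>, of "\<bar>lam\<bar> * x powr \<beta>"] by simp
  have U_pos: "0 < U x" for x using U1[of x] by linarith
  have "continuous_on {0..T} (\<lambda>x. \<bar>w x\<bar> / U x)"
    using U_pos by (intro continuous_intros w_cont U_cont) (metis less_irrefl)
  then obtain x0 where x0: "x0 \<in> {0..T}" "\<And>x. x \<in> {0..T} \<Longrightarrow> \<bar>w x\<bar> / U x \<le> \<bar>w x0\<bar> / U x0"
    using continuous_attains_sup[of "{0..T}" "\<lambda>x. \<bar>w x\<bar> / U x"] T by auto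
  define m where "m = \<bar>w x0\<bar> / U x0"
  define y where "y x = m * U x - \<bar>w x\<bar>" for x
  have "0 < \<bar>w x\<bar> / U x" using neq U_pos[of x] by (simp add: w_def)
  with x0(2)[OF x] have "0 < m" by (simp add: m_def)
  have w0: "w 0 = 0" using v1 v2 by (simp add: w_def solves_linear_ivp_def)
  have "x0 \<noteq> 0" using \<open>0 < m\<close> w0 by (auto simp: m_def)
  with x0 have x0': "0 < x0" "x0 \<le> T" "x0 \<in> {0<..T}" by auto
  have y_nonneg: "0 \<le> y r" if "0 \<le> r" "r \<le> x0" for r
    using x0(2)[of r] U_pos[of r] that x0' by (simp add: y_def m_def field_simps)
  have y_cont: "continuous_on {0..T} y" unfolding y_def by (intro continuous_intros w_cont U_cont)
  have "0 < y 0" using \<open>0 < m\<close> w0 U_pos[of 0] by (simp add: y_def)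
  have "y x0 = 0" using U_pos[of x0] by (simp add: y_def m_def)
  let ?k = "\<lambda>l r. censored_kernel \<beta> l x0 r"
  have k_int: "set_integrable lborel {0<..<x0} (\<lambda>r. ?k l r * f r)"
    if "continuous_on {0..T} f" for l f
    by (rule censored_kernel_integral(1)[OF \<beta> that x0'(1,2)])
  \<comment> \<open>The integral of \<open>y\<close> is positive, yet by the equation for
    \<open>U\<close> it equals \<open>|w x0|\<close> minus the integral of \<open>|w|\<close>, which
    is shown to be at most 0.\<close>
  have "0 < (LBINT r:{0<..<x0}. ?k \<bar>lam\<bar> r * y r)"
    by (rule censored_kernel_integral_pos[OF \<beta> y_cont x0'(1,2)])
      (use y_nonneg \<open>0 < y 0\<close> in auto)
  also have "\<dots> = (LBINT r:{0<..<x0}. m * (?k \<bar>lam\<bar> r * U r) - ?k \<bar>lam\<bar> r * \<bar>w r\<bar>)"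
    by (simp add: y_def algebra_simps)
  also have "\<dots> = m * (LBINT r:{0<..<x0}. ?k \<bar>lam\<bar> r * U r) - (LBINT r:{0<..<x0}. ?k \<bar>lam\<bar> r * \<bar>w r\<bar>)"
    by (subst set_integral_diff(2))
      (auto intro!: set_integrable_mult_right k_int U_cont w_cont continuous_intros)
  also have "(LBINT r:{0<..<x0}. ?k \<bar>lam\<bar> r * U r) = U x0"
    using solves_linear_ivp_integral_equation[OF \<beta> T U_sol x0'(3)] by simp
  also have "m * U x0 = \<bar>w x0\<bar>" using U_pos[of x0] by (simp add: m_def)
  \<comment> \<open>\<open>|w|\<close> is a subsolution for \<open>|lam|\<close>: by linearity
    \<open>w\<close> satisfies the integral equation for \<open>lam\<close>, and the kernel for
    \<open>|lam|\<close> dominates the absolute value of the one for \<open>lam\<close>.\<close>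
  also have "\<bar>w x0\<bar> - (LBINT r:{0<..<x0}. ?k \<bar>lam\<bar> r * \<bar>w r\<bar>) \<le> 0"
  proof -
    have "w x0 = (LBINT r:{0<..<x0}. ?k lam r * v1 r) - (LBINT r:{0<..<x0}. ?k lam r * v2 r)"
      using solves_linear_ivp_integral_equation[OF \<beta> T v1 x0'(3)]
        solves_linear_ivp_integral_equation[OF \<beta> T v2 x0'(3)] by (simp add: w_def)
    also have "\<dots> = (LBINT r:{0<..<x0}. ?k lam r * w r)"
      unfolding w_def right_diff_distrib by (intro set_integral_diff(2)[symmetric] k_int v_cont)
    finally have "\<bar>w x0\<bar> = norm (LBINT r:{0<..<x0}. ?k lam r * w r)" by simp
    also have "\<dots> \<le> (LBINT r:{0<..<x0}. norm (?k lam r * w r))"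
      by (rule set_integral_norm_bound[OF k_int[OF w_cont]])
    also have "\<dots> \<le> (LBINT r:{0<..<x0}. ?k \<bar>lam\<bar> r * \<bar>w r\<bar>)"
    proof (rule set_integral_mono)
      show "set_integrable lborel {0<..<x0} (\<lambda>r. norm (?k lam r * w r))"
        by (intro set_integrable_norm k_int w_cont)
      show "set_integrable lborel {0<..<x0} (\<lambda>r. ?k \<bar>lam\<bar> r * \<bar>w r\<bar>)"
        by (intro k_int continuous_intros w_cont)
      fix r
      have G: "0 < Gamma \<beta>" "0 < Gamma (1 - \<beta>)" using \<beta> by (auto intro!: Gamma_real_pos)
      have "\<bar>r powr - \<beta> / Gamma (1 - \<beta>) + lam\<bar> \<le> r powr - \<beta> / Gamma (1 - \<beta>) + \<bar>lam\<bar>"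
        using G by (intro order_trans[OF abs_triangle_ineq]) simp
      then have "\<bar>?k lam r\<bar> \<le> ?k \<bar>lam\<bar> r"
        using G by (simp add: censored_kernel_def abs_mult mult_left_mono divide_right_mono)
      then show "norm (?k lam r * w r) \<le> ?k \<bar>lam\<bar> r * \<bar>w r\<bar>"
        by (simp add: abs_mult mult_right_mono)
    qed
    finally show ?thesis by simp
  qed
  finally show False by simp
qed

theorem lemma3p15:
  fixes \<beta> T lam u0 :: real
  assumes "0 < \<beta>" and "\<beta> < 1" and "0 < T"
  shows "\<exists>u. solves_linear_ivp \<beta> T lam u0 u
           \<and> (\<forall>v. solves_linear_ivp \<beta> T lam u0 v \<longrightarrow> (\<forall>x\<in>{0..T}. v x = u x))
           \<and> (\<forall>x\<in>{0..T}.
                summable (\<lambda>N. lam ^ N * (censored_int \<beta> ^^ N) (\<lambda>_. 1) x)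
              \<and> u x = u0 * (\<Sum>N. lam ^ N * (censored_int \<beta> ^^ N) (\<lambda>_. 1) x)
              \<and> summable (series_term \<beta> lam x)
              \<and> u x = u0 * (\<Sum>N. series_term \<beta> lam x N)
              \<and> (lam = 0 \<longrightarrow> u x = u0))"
proof (intro exI[of _ "\<lambda>x. u0 * censored_exp \<beta> (lam * x powr \<beta>)"] conjI allI impI ballI)
  note sol = solves_linear_ivp_censored_exp[OF assms, of lam u0]
  show "solves_linear_ivp \<beta> T lam u0 (\<lambda>x. u0 * censored_exp \<beta> (lam * x powr \<beta>))" by (rule sol)
  show "v x = u0 * censored_exp \<beta> (lam * x powr \<beta>)"
    if "solves_linear_ivp \<beta> T lam u0 v" "x \<in> {0..T}" for v x
    using solves_linear_ivp_unique[OF assms that(1) sol that(2)] .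
  fix x assume x: "x \<in> {0..T}"
  \<comment> \<open>The two series agree term by term, also at \<open>x = 0\<close>, where only the
    term \<open>N = 0\<close> survives.\<close>
  have iter: "lam ^ N * (censored_int \<beta> ^^ N) (\<lambda>_. 1) x = series_term \<beta> lam x N" for N
    using censored_int_funpow_1[OF assms(1,2), of x N] x
    by (simp add: series_term_eq power_mult_distrib)
  have sums: "series_term \<beta> lam x sums censored_exp \<beta> (lam * x powr \<beta>)"
    unfolding series_term_eq[abs_def] by (rule sums_censored_exp[OF assms(1,2)])
  then show "summable (series_term \<beta> lam x)"
    "summable (\<lambda>N. lam ^ N * (censored_int \<beta> ^^ N) (\<lambda>_. 1) x)"
    unfolding iter by (auto simp: sums_iff)
  show "u0 * censored_exp \<beta> (lam * x powr \<beta>) = u0 * (\<Sum>N. series_term \<beta> lam x N)"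
    "u0 * censored_exp \<beta> (lam * x powr \<beta>) = u0 * (\<Sum>N. lam ^ N * (censored_int \<beta> ^^ N) (\<lambda>_. 1) x)"
    unfolding iter using sums by (auto simp: sums_iff)
  show "u0 * censored_exp \<beta> (lam * x powr \<beta>) = u0" if "lam = 0"
    using that by (simp add: censored_exp_0)
qed

end
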